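(* Every graph $G$ of treewidth $k$ has a subdivision $H$ whose radius-$1$ blind cop-width is at most $k+3$.
   Context: All graphs are finite, simple and undirected. A subdivision of $G$ is obtained by replacing each edge by a path of nonzero length, with these paths internally disjoint. For a graph $G$, a blind strategy of radius $1$ is a sequence $C_1,\dots,C_m\subseteq V(G)$ using $\max_i|C_i|$ cops, with $A_1=V(G)\setminus C_1$ and $A_{i+1}$ the set of $u\in V(G)\setminus C_{i+1}$ reachable from some vertex of $A_i$ by a path of length at most $1$ (length $0$ allowed) in $G\setminus(C_i\cap C_{i+1})$; it is winning if $A_m=\emptyset$. The radius-$1$ blind cop-width $\mathrm{bcw}_1(G)$ is the minimum number of cops of a winning strategy. *)

theory Defs
  imports "Graph_Theory.Graph_Theory"
begin

text \<open>
  A finite simple undirected graph is a \<^term>\<open>G :: 'a pair_pre_digraph\<close> satisfying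
  \<^const>\<open>pair_graph\<close>: the edge \<open>uv\<close> is the pair of arcs \<open>(u, v)\<close>, \<open>(v, u)\<close>.
\<close>

text \<open>
  \<open>H\<close> is a subdivision of \<open>G\<close> up to renaming: \<open>f\<close> places the vertices of \<open>G\<close> in \<open>H\<close>, and
  \<open>P (u, v)\<close> is the path replacing the edge \<open>uv\<close>, traversed from \<open>f u\<close> to \<open>f v\<close>. The
  renaming lets \<open>H\<close> live on another vertex type, which is needed when \<open>'a\<close> has too few elements.
\<close>

definition internal_verts :: "'a list \<Rightarrow> 'a set" where
  "internal_verts p = set (butlast (tl p))"

definition subdivision_of :: "'a pair_pre_digraph \<Rightarrow> 'b pair_pre_digraph \<Rightarrow> bool" where
  "subdivision_of G H \<longleftrightarrow> (\<exists>f P.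
      inj_on f (pverts G)
    \<and> (\<forall>(u, v) \<in> parcs G.
          vpath (P (u, v)) (with_proj H) \<and> hd (P (u, v)) = f u \<and> last (P (u, v)) = f v
        \<and> vwalk_length (P (u, v)) \<noteq> 0
        \<and> P (v, u) = rev (P (u, v))
        \<and> internal_verts (P (u, v)) \<inter> f ` pverts G = {})
    \<and> (\<forall>(u, v) \<in> parcs G. \<forall>(x, y) \<in> parcs G. {u, v} \<noteq> {x, y} \<longrightarrow>
          internal_verts (P (u, v)) \<inter> internal_verts (P (x, y)) = {})
    \<and> pverts H = f ` pverts G \<union> (\<Union>e \<in> parcs G. internal_verts (P e))
    \<and> parcs H = (\<Union>e \<in> parcs G. set (vwalk_arcs (P e))))"

text \<open>
  The library's \<^const>\<open>tree\<close> forbids directed cycles, including \<open>u, v, u\<close>, so a symmetric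
  digraph with an edge is never a \<^const>\<open>tree\<close>; hence the separate notion for undirected graphs.
\<close>

definition undirected_tree :: "'a pair_pre_digraph \<Rightarrow> bool" where
  "undirected_tree T \<longleftrightarrow> pair_graph T \<and> connected (with_proj T)
    \<and> \<not> (\<exists>p. vpath p (with_proj T) \<and> 3 \<le> length p \<and> (last p, hd p) \<in> parcs T)"

definition tree_decomposition ::
    "'a pair_pre_digraph \<Rightarrow> 't pair_pre_digraph \<Rightarrow> ('t \<Rightarrow> 'a set) \<Rightarrow> bool" where
  "tree_decomposition G T B \<longleftrightarrow> undirected_tree T
    \<and> (\<Union>t \<in> pverts T. B t) = pverts G
    \<and> (\<forall>(u, v) \<in> parcs G. \<exists>t \<in> pverts T. u \<in> B t \<and> v \<in> B t)
    \<and> (\<forall>v \<in> pverts G. connected (with_proj T \<restriction> {t \<in> pverts T. v \<in> B t}))"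

definition decomposition_width :: "'t pair_pre_digraph \<Rightarrow> ('t \<Rightarrow> 'a set) \<Rightarrow> int" where
  "decomposition_width T B = int (Max ((\<lambda>t. card (B t)) ` pverts T)) - 1"

text \<open>
  Decomposition trees are finite, so natural numbers suffice as their nodes. The graph without
  vertices has treewidth \<open>-1\<close>.
\<close>

definition treewidth :: "'a pair_pre_digraph \<Rightarrow> int" where
  "treewidth G = (LEAST w. \<exists>(T :: nat pair_pre_digraph) B.
     tree_decomposition G T B \<and> w = decomposition_width T B)"

text \<open>\<open>robber_territory r G Cs i\<close> is \<open>A\<^bsub>i+1\<^esub>\<close> for the strategy \<open>C\<^sub>1, \<dots>, C\<^sub>m\<close> given by the list \<open>Cs\<close>.\<close>

primrec robber_territory ::
    "nat \<Rightarrow> 'a pair_pre_digraph \<Rightarrow> 'a set list \<Rightarrow> nat \<Rightarrow> 'a set" where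
  "robber_territory r G Cs 0 = pverts G - Cs ! 0"
| "robber_territory r G Cs (Suc i) =
     {u \<in> pverts G - Cs ! Suc i. \<exists>a \<in> robber_territory r G Cs i. \<exists>p.
        vpath p (with_proj G \<restriction> (pverts G - (Cs ! i \<inter> Cs ! Suc i)))
        \<and> hd p = a \<and> last p = u \<and> vwalk_length p \<le> r}"

definition winning_blind_strategy :: "nat \<Rightarrow> 'a pair_pre_digraph \<Rightarrow> 'a set list \<Rightarrow> bool" where
  "winning_blind_strategy r G Cs \<longleftrightarrow>
     Cs \<noteq> [] \<and> (\<forall>C \<in> set Cs. C \<subseteq> pverts G) \<and> robber_territory r G Cs (length Cs - 1) = {}"

definition blind_cop_width :: "nat \<Rightarrow> 'a pair_pre_digraph \<Rightarrow> nat" where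
  "blind_cop_width r G =
     (LEAST c. \<exists>Cs. winning_blind_strategy r G Cs \<and> c = Max (card ` set Cs))"

end

theory Submission
  imports Defs
begin

text \<open>
  Since a contamination front moves at speed one, long edges act as delays. Keep the cops on a bag
  \<open>X\<close> of a tree decomposition and use two more cops, walking side by side, to sweep the edges inside
  the bag. After the subtree of one child has been cleaned, the bag is abandoned to clean the next
  one. Meanwhile the robber enters the first subtree, but if the edges there are much longer than
  the time this takes, only short initial segments of edges starting in \<open>X\<close> get contaminated, and
  they are swept back as soon as \<open>X\<close> is guarded again. Hence the lengths are chosen in the reverse
  of the order in which the subtrees are cleaned.
\<close>

section \<open>The abstract search\<close>

text \<open>A bag has at most \<open>k + 1\<close> vertices, and the two sweepers bring the count to
  \<open>k + 3\<close>. The obstacle is circular: the time needed for a subtree depends on its edge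
  lengths, which must exceed the time spent elsewhere. So each subtree gets a strategy that fixes
  the lengths of its own edges only, works from every configuration, and has a time bound
  independent of all other lengths. Upper bounds on the territory suffice because robber moves are
  monotone in it.\<close>

locale cop_game =
  fixes V :: "'a set" and A :: "('a \<times> 'a) set" and K :: nat
  assumes finite_V: "finite V"
    and arcs_in_V: "A \<subseteq> V \<times> V"
    and arcs_sym: "e \<in> A \<Longrightarrow> prod.swap e \<in> A"
    and arcs_irrefl: "(v, v) \<notin> A"
begin

lemma finite_A: "finite A"
  using finite_V arcs_in_V finite_subset[of A "V \<times> V"] by auto

text \<open>
  A configuration \<open>(F, p)\<close> bounds the robber territory in a subdivision with edge lengths \<open>l\<close>:
  \<open>F\<close> contains the contaminated branch vertices, and a contaminated inner vertex of the edge \<open>uv\<close>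
  has distance at most \<open>p (u, v)\<close> from \<open>u\<close> or at most \<open>p (v, u)\<close> from \<open>v\<close> along that edge.
\<close>

definition valid_lengths :: "('a \<times> 'a \<Rightarrow> nat) \<Rightarrow> bool" where
  "valid_lengths l \<longleftrightarrow> (\<forall>e\<in>A. 2 \<le> l e \<and> l (prod.swap e) = l e)"

definition spread :: "('a \<times> 'a \<Rightarrow> nat) \<Rightarrow> 'a set \<Rightarrow> 'a set \<Rightarrow> ('a \<times> 'a \<Rightarrow> nat) \<Rightarrow> 'a set" where
  "spread l X F p = (F \<union> {fst e |e. e \<in> A \<and> 0 < p e} \<union> {snd e |e. e \<in> A \<and> l e \<le> Suc (p e)}) - X"

definition grow :: "'a set \<Rightarrow> ('a \<times> 'a \<Rightarrow> nat) \<Rightarrow> 'a \<times> 'a \<Rightarrow> nat" where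
  "grow F p e = (if p e = 0 \<and> fst e \<notin> F then 0 else Suc (p e))"

text \<open>
  In \<open>sweep\<close>, two extra cops stand on the vertices at distance \<open>p e\<close> and \<open>p e + 1\<close> along \<open>e\<close>; one
  cop would not do, as the robber can swap places with it. \<open>refill\<close> costs no time: it only replaces
  the bound for an edge by the one that describes a fully contaminated edge from one of its ends.
\<close>

inductive reach :: "('a \<times> 'a \<Rightarrow> nat) \<Rightarrow> ('a \<times> 'a) set \<Rightarrow> nat \<Rightarrow>
    'a set \<times> ('a \<times> 'a \<Rightarrow> nat) \<Rightarrow> 'a set \<Rightarrow> ('a \<times> 'a \<Rightarrow> nat) \<Rightarrow> bool"
  for l E where
  start: "reach l E 0 (F, p) F p"
| guard: "reach l E n c F p \<Longrightarrow> X \<subseteq> V \<Longrightarrow> card X \<le> K \<Longrightarrow>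
    reach l E (Suc n) c (spread l X F p) (grow F p)"
| sweep: "reach l E n c F p \<Longrightarrow> X \<subseteq> V \<Longrightarrow> card X \<le> K \<Longrightarrow> e \<in> A \<Longrightarrow> 0 < p e \<Longrightarrow> p e < l e \<Longrightarrow>
    reach l E (Suc n) c (spread l X F p) ((grow F p)(e := p e - 1))"
| refill: "reach l E n c F p \<Longrightarrow> e \<in> E \<Longrightarrow> e \<in> A \<Longrightarrow>
    reach l E n c F (p(e := l e - 1, prod.swap e := 0))"

lemma reach_trans:
  assumes "reach l E m (F', p') F'' p''" and "reach l E n c F' p'"
  shows "reach l E (n + m) c F'' p''"
  using assms
  by (induction m "(F', p')" F'' p'' rule: reach.induct)
    (simp_all only: add_0_right add_Suc_right reach.intros)

lemma reach_mono: "reach l E n c F p \<Longrightarrow> E \<subseteq> E' \<Longrightarrow> reach l E' n c F p"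
  by (induction rule: reach.induct) (simp_all only: reach.intros subsetD)

text \<open>
  \<open>elim X E W\<close> corresponds to a subtree of a tree decomposition: \<open>X\<close> is its root bag, \<open>E\<close> the set of
  arcs cleaned in the subtree, and \<open>W\<close> the set of vertices that occur only strictly below the root.
\<close>

inductive elim :: "'a set \<Rightarrow> ('a \<times> 'a) set \<Rightarrow> 'a set \<Rightarrow> bool" where
  bag: "X \<subseteq> V \<Longrightarrow> card X \<le> K \<Longrightarrow> elim X {} {}"
| edge: "X \<subseteq> V \<Longrightarrow> card X \<le> K \<Longrightarrow> (u, v) \<in> A \<Longrightarrow> u \<in> X \<Longrightarrow> v \<in> X \<Longrightarrow>
    elim X {(u, v), (v, u)} {}"
| forget: "elim X E W \<Longrightarrow> Y \<subseteq> V \<Longrightarrow> card Y \<le> K \<Longrightarrow>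
    (\<And>e. e \<in> A \<Longrightarrow> fst e \<in> X - Y \<Longrightarrow> e \<in> E) \<Longrightarrow> elim Y E (W \<union> (X - Y))"
| join: "elim X E1 W1 \<Longrightarrow> elim X E2 W2 \<Longrightarrow> E1 \<inter> E2 = {} \<Longrightarrow> elim X (E1 \<union> E2) (W1 \<union> W2)"

text \<open>\<open>X\<close> separates \<open>W\<close> from the rest: by closure under reversal no
  arc joins \<open>W\<close> to a vertex outside \<open>X\<close> and \<open>W\<close>, so
  contamination can enter \<open>W\<close> only through \<open>X\<close>.\<close>

definition region :: "'a set \<Rightarrow> ('a \<times> 'a) set \<Rightarrow> 'a set \<Rightarrow> bool" where
  "region X E W \<longleftrightarrow> X \<subseteq> V \<and> card X \<le> K \<and> E \<subseteq> A \<and> (\<forall>e\<in>E. prod.swap e \<in> E) \<and>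
     (\<forall>e\<in>E. fst e \<in> X \<union> W) \<and> (\<forall>e\<in>A. fst e \<in> W \<longrightarrow> e \<in> E)"

lemma elim_region: "elim X E W \<Longrightarrow> region X E W"
proof (induction rule: elim.induct)
  case (edge X u v)
  then show ?case using arcs_sym[of "(u, v)"] by (auto simp: region_def)
next
  case (forget X E W Y)
  then show ?case unfolding region_def by blast
next
  case (join X E1 W1 E2 W2)
  then show ?case unfolding region_def by blast
qed (auto simp: region_def)

lemma region_snd: "region X E W \<Longrightarrow> e \<in> A \<Longrightarrow> snd e \<in> W \<Longrightarrow> e \<in> E"
  using arcs_sym[of e] unfolding region_def by (metis fst_swap swap_swap)

lemma region_finite: "region X E W \<Longrightarrow> finite E"
  using finite_A finite_subset by (auto simp: region_def)

section \<open>Guarding and sweeping\<close>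

definition clean :: "'a set \<Rightarrow> ('a \<times> 'a) set \<Rightarrow> 'a set \<Rightarrow> 'a set \<Rightarrow> ('a \<times> 'a \<Rightarrow> nat) \<Rightarrow> bool" where
  "clean X E W F p \<longleftrightarrow> F \<inter> (X \<union> W) = {} \<and> (\<forall>e\<in>E. p e = 0)"

text \<open>A vertex of \<open>W\<close> outside \<open>X\<close> is entered only along an arc of
  \<open>E\<close>. A dirty one lies in \<open>S\<close>, so it starts in \<open>X\<close> and its
  dirty segment stops short of the far end. Ends in \<open>X\<close> need no such bound, being
  guarded.\<close>

lemma spread_guarded:
  assumes reg: "region X E W" and l: "valid_lengths l"
    and S: "S \<subseteq> E" "\<And>e. e \<in> S \<Longrightarrow> fst e \<in> X"
    and cl: "clean X (E - S) W F p"
    and b: "\<And>e. e \<in> S \<Longrightarrow> snd e \<notin> X \<Longrightarrow> Suc (p e) < l e"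
  shows "spread l X F p \<inter> (X \<union> W) = {}"
proof -
  have "fst e \<notin> W - X" if "e \<in> A" "0 < p e" for e
  proof
    assume w: "fst e \<in> W - X"
    then have "e \<in> E" using reg that by (auto simp: region_def)
    moreover have "e \<notin> S" using S(2) w by blast
    ultimately show False using cl that by (auto simp: clean_def)
  qed
  moreover have "snd e \<notin> W - X" if "e \<in> A" "l e \<le> Suc (p e)" for e
  proof
    assume w: "snd e \<in> W - X"
    then have "e \<in> E" using region_snd[OF reg that(1)] by blast
    moreover have "e \<notin> S" using b[of e] w that by auto
    ultimately show False using cl that l by (fastforce simp: clean_def valid_lengths_def)
  qed
  ultimately show ?thesis using cl unfolding spread_def clean_def by blast
qed

lemma grow_guarded:
  assumes "region X E W" and "clean X (E - S) W F p" and "e \<in> E - S"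
  shows "grow F p e = 0"
  using assms unfolding region_def clean_def grow_def by auto

text \<open>The sweep takes \<open>p a\<close> rounds, in which the waiting segments grow by one per
  round; hence \<open>b + p a\<close>. Exempting arcs that end in \<open>X\<close> from the length
  condition allows \<open>a\<close> to be a fully contaminated edge inside the bag.\<close>

lemma sweep_arc:
  assumes reg: "region X E W" and l: "valid_lengths l"
    and S: "S \<subseteq> E" "\<And>e. e \<in> S \<Longrightarrow> fst e \<in> X"
    and "a \<in> S" and "clean X (E - S) W F p" and "p a < l a"
    and "\<And>e. e \<in> S \<Longrightarrow> p e \<le> b"
    and "\<And>e. e \<in> S \<Longrightarrow> snd e \<notin> X \<Longrightarrow> b + p a < l e"
  shows "\<exists>F' p'. reach l E' (p a) (F, p) F' p' \<and> clean X (E - (S - {a})) W F' p' \<and>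
    (\<forall>e\<in>S. p' e \<le> b + p a)"
  using assms(5-)
proof (induction "p a" arbitrary: F p b)
  case 0
  then have "clean X (E - (S - {a})) W F p" by (auto simp: clean_def)
  then show ?case using 0 by (metis add_0_right reach.start)
next
  case (Suc q)
  define F1 p1 where "F1 = spread l X F p" and "p1 = (grow F p)(a := p a - 1)"
  have p1a: "q = p1 a" using Suc.hyps(2) by (simp add: p1_def)
  have "Suc (p e) < l e" if "e \<in> S" "snd e \<notin> X" for e
    using Suc.prems(4)[OF that(1)] Suc.prems(5)[OF that] Suc.hyps(2) by linarith
  then have F1: "F1 \<inter> (X \<union> W) = {}"
    unfolding F1_def using spread_guarded[OF reg l S Suc.prems(2)] by blast
  have cl1: "clean X (E - S) W F1 p1"
    using F1 grow_guarded[OF reg Suc.prems(2)] Suc.prems(1) by (auto simp: clean_def p1_def)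
  have b1: "p1 e \<le> Suc b" if "e \<in> S" for e
    using Suc.prems(4)[OF that] by (auto simp: p1_def grow_def)
  have "Suc b + p1 a < l e" if "e \<in> S" "snd e \<notin> X" for e
    using Suc.prems(5)[OF that] Suc.hyps(2) p1a by linarith
  then obtain F' p' where r: "reach l E' q (F1, p1) F' p'"
    and res: "clean X (E - (S - {a})) W F' p'" "\<forall>e\<in>S. p' e \<le> Suc b + q"
    using Suc.hyps(1)[OF p1a Suc.prems(1) cl1 _ b1] Suc.prems(3) Suc.hyps(2) p1a by auto
  have "reach l E' (Suc 0) (F, p) F1 p1"
    unfolding F1_def p1_def
    using reg S(1) Suc.prems(1,3) Suc.hyps(2)
    by (intro reach.sweep reach.start) (auto simp: region_def)
  from reach_trans[OF r this] have "reach l E' (p a) (F, p) F' p'"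
    using Suc.hyps(2) by simp
  then show ?case using res Suc.hyps(2) by (metis add_Suc_shift)
qed

text \<open>Each sweep at most doubles the bound, so the total time is at most
  \<open>b + 2 * b + 4 * b + ...\<close>, that is \<open>(2 ^ card S - 1) * b\<close>; adding
  \<open>b\<close> on the left avoids subtraction on \<open>nat\<close>.\<close>

lemma sweep_arcs:
  assumes reg: "region X E W" and l: "valid_lengths l"
    and "finite S" and "S \<subseteq> E" and "\<And>e. e \<in> S \<Longrightarrow> fst e \<in> X"
    and "clean X (E - S) W F p" and "\<And>e. e \<in> S \<Longrightarrow> p e \<le> b"
    and "\<And>e. e \<in> S \<Longrightarrow> 2 ^ card S * b < l e"
  shows "\<exists>n F' p'. n + b \<le> 2 ^ card S * b \<and> reach l E' n (F, p) F' p' \<and> clean X E W F' p'"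
  using assms(3-)
proof (induction S arbitrary: F p b rule: finite_induct)
  case empty
  then show ?case by (intro exI[of _ 0] exI[of _ F] exI[of _ p]) (auto intro: reach.start)
next
  case (insert a S)
  have pa: "p a \<le> b" using insert.prems by blast
  have len: "b + b < l e" if "e \<in> insert a S" for e
  proof -
    have "2 * b \<le> 2 ^ card (insert a S) * b" using insert.hyps by simp
    then show ?thesis using insert.prems(5)[OF that] by linarith
  qed
  have b: "b + p a < l e" if "e \<in> insert a S" for e
    using len[OF that] pa by linarith
  have "p a < l a" using len[of a] pa by simp
  then obtain F1 p1 where r1: "reach l E' (p a) (F, p) F1 p1"
    and c1: "clean X (E - S) W F1 p1" and b1: "\<forall>e\<in>S. p1 e \<le> b + p a"
    using sweep_arc[OF reg l insert.prems(1,2), of a F p b E'] insert.prems(3,4) insert.hyps b by auto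
  have "p1 e \<le> 2 * b" if "e \<in> S" for e using b1 that pa by (metis add_left_mono le_trans mult_2)
  moreover have "2 ^ card S * (2 * b) < l e" if "e \<in> S" for e
    using insert.prems(5)[of e] that insert.hyps by (simp add: mult.assoc mult.left_commute)
  ultimately obtain n F' p' where n: "n + 2 * b \<le> 2 ^ card S * (2 * b)"
    and r: "reach l E' n (F1, p1) F' p'" and c: "clean X E W F' p'"
    using insert.IH[of F1 p1 "2 * b"] insert.prems(1,2) c1 by auto
  have "p a + n + b \<le> 2 ^ card (insert a S) * b"
    using n pa insert.hyps by (simp add: mult.assoc mult.left_commute)
  then show ?case using reach_trans[OF r r1] c by blast
qed

text \<open>While \<open>E'\<close> is cleaned the cops may stand anywhere, so \<open>X\<close>
  counts as lost. Contamination enters \<open>E\<close> only along arcs leaving \<open>X\<close>,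
  one position per round, and \<open>n\<close> rounds are too few to reach a far end. No
  \<open>refill\<close> interferes, as \<open>E\<close> is closed under reversal and disjoint from
  \<open>E'\<close>.\<close>

lemma reach_decay:
  assumes "reach l E' n c F p" and "c = (F0, p0)"
    and reg: "region X E W" and l: "valid_lengths l" and disj: "E \<inter> E' = {}"
    and cl: "clean X E W F0 p0"
    and "\<And>e. e \<in> E \<Longrightarrow> Suc n < l e"
  shows "F \<inter> (W - X) = {} \<and> (\<forall>e\<in>E. p e \<le> n \<and> (fst e \<notin> X \<longrightarrow> p e = 0))"
proof -
  have step: "spread l Y F p \<inter> (W - X) = {} \<and>
      (\<forall>e\<in>E. grow F p e \<le> Suc n \<and> (fst e \<notin> X \<longrightarrow> grow F p e = 0))"
    if F: "F \<inter> (W - X) = {}" and p: "\<forall>e\<in>E. p e \<le> n \<and> (fst e \<notin> X \<longrightarrow> p e = 0)"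
      and len: "\<And>e. e \<in> E \<Longrightarrow> Suc (Suc n) < l e" for n F p Y
  proof -
    have "fst e \<notin> W - X" if "e \<in> A" "0 < p e" for e
      using that p reg by (auto simp: region_def)
    moreover have "snd e \<notin> W - X" if "e \<in> A" "l e \<le> Suc (p e)" for e
      using that p len[of e] region_snd[OF reg that(1)] by fastforce
    ultimately have "spread l Y F p \<inter> (W - X) = {}" using F by (auto simp: spread_def)
    moreover have "fst e \<notin> F" if "e \<in> E" "fst e \<notin> X" for e
      using that F reg by (auto simp: region_def)
    ultimately show ?thesis using p by (auto simp: grow_def)
  qed
  show ?thesis
    using assms(1,2,7)
  proof (induction rule: reach.induct)
    case (start F p)
    then show ?case using cl by (auto simp: clean_def)
  next
    case (guard n c F p Y)
    then show ?case using step[of F p n Y] Suc_lessD by blast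
  next
    case (sweep n c F p Y a)
    then have "F \<inter> (W - X) = {}" "\<forall>e\<in>E. p e \<le> n \<and> (fst e \<notin> X \<longrightarrow> p e = 0)"
      using Suc_lessD by blast+
    then show ?case using step[of F p n Y] sweep.prems(2)
      by (simp add: le_diff_conv) (meson le_SucI)
  next
    case (refill n c F p a)
    then have "e \<noteq> a \<and> e \<noteq> prod.swap a" if "e \<in> E" for e
      using that disj reg unfolding region_def by (metis disjoint_iff swap_swap)
    then show ?case using refill by simp
  qed
qed

text \<open>
  The lower bound \<open>N\<close> is what makes the join work: the lengths on \<open>E1\<close> are chosen after those on
  \<open>E2\<close>, so large that the time \<open>T2\<close> spent on \<open>E2\<close> recontaminates only short initial segments of
  the arcs in \<open>E1\<close>; these are swept one by one with \<open>X\<close> guarded, which at most doubles the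
  remaining segments each time.
\<close>

lemma elim_strategy:
  assumes "elim X E W"
  shows "\<exists>l0 T. (\<forall>e\<in>E. N \<le> l0 e \<and> 2 \<le> l0 e \<and> l0 (prod.swap e) = l0 e) \<and>
    (\<forall>l c. valid_lengths l \<longrightarrow> (\<forall>e\<in>E. l e = l0 e) \<longrightarrow>
      (\<exists>n F p. n \<le> T \<and> reach l E n c F p \<and> clean X E W F p))"
  using assms
proof (induction arbitrary: N rule: elim.induct)
  case (bag X)
  have "\<exists>n F p. n \<le> 1 \<and> reach l {} n c F p \<and> clean X {} {} F p" for l c
    using reach.guard[OF reach.start bag, of l "{}" "fst c" "snd c"]
    by (intro exI[of _ 1]) (fastforce simp: clean_def spread_def)
  then show ?case by blast
next
  case (edge X u v)
  let ?E = "{(u, v), (v, u)}"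
  have reg: "region X ?E {}" using elim_region elim.edge[OF edge] by blast
  have uv: "u \<noteq> v" using arcs_irrefl edge by auto
  have "\<exists>n F p. n \<le> N + 2 \<and> reach l ?E n c F p \<and> clean X ?E {} F p"
    if l: "valid_lengths l" and len: "\<forall>e\<in>?E. l e = N + 2" for l c
  proof -
    obtain F0 p0 where c: "c = (F0, p0)" by fastforce
    \<comment> \<open>After one round on \<open>X\<close>, the edge is taken as contaminated from
      \<open>u\<close> up to the vertex before \<open>v\<close>. A single sweep of
      \<open>N + 1\<close> rounds then clears both arcs.\<close>
    define F1 p1 where "F1 = spread l X F0 p0"
      and "p1 = (grow F0 p0)((u, v) := l (u, v) - 1, prod.swap (u, v) := 0)"
    have r1: "reach l ?E (Suc 0) c F1 p1"
      unfolding c F1_def p1_def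
      by (rule reach.refill[OF reach.guard[OF reach.start edge(1,2)]]) (use edge in auto)
    have "clean X (?E - {(u, v)}) {} F1 p1"
      using uv by (auto simp: clean_def F1_def p1_def spread_def)
    then obtain F p where "reach l ?E (p1 (u, v)) (F1, p1) F p"
      and "clean X (?E - ({(u, v)} - {(u, v)})) {} F p"
      using sweep_arc[OF reg l, of "{(u, v)}" "(u, v)" F1 p1 "p1 (u, v)" ?E] edge uv len
      by (auto simp: p1_def)
    moreover have "p1 (u, v) = N + 1" using len uv by (simp add: p1_def)
    ultimately show ?thesis using reach_trans[OF _ r1]
      by (intro exI[of _ "N + 2"]) fastforce
  qed
  then show ?case by (intro exI[of _ "\<lambda>_. N + 2"] exI[of _ "N + 2"]) simp
next
  case (forget X E W Y)
  note reg = elim_region[OF forget.hyps(1)]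
  obtain l0 T where l0: "\<forall>e\<in>E. N \<le> l0 e \<and> 2 \<le> l0 e \<and> l0 (prod.swap e) = l0 e"
    and T: "\<And>l c. valid_lengths l \<Longrightarrow> \<forall>e\<in>E. l e = l0 e \<Longrightarrow>
      \<exists>n F p. n \<le> T \<and> reach l E n c F p \<and> clean X E W F p"
    using forget.IH[of N] by metis
  have "\<exists>n F p. n \<le> Suc T \<and> reach l E n c F p \<and> clean Y E (W \<union> (X - Y)) F p"
    if l: "valid_lengths l" and len: "\<forall>e\<in>E. l e = l0 e" for l c
  proof -
    obtain n F p where n: "n \<le> T" and r: "reach l E n c F p" and cl: "clean X E W F p"
      using T[OF l len] by blast
    \<comment> \<open>No arc outside \<open>E\<close> touches \<open>W\<close> or
      \<open>X - Y\<close>, so nothing returns there once only \<open>Y\<close> is guarded.\<close>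
    have E: "e \<in> E" if "e \<in> A" "fst e \<in> W \<union> (X - Y) \<or> snd e \<in> W \<union> (X - Y)" for e
      using that forget.hyps(4) reg arcs_sym[of e] region_snd[OF reg] unfolding region_def
      by (metis Un_iff fst_swap swap_swap)
    have "clean Y E (W \<union> (X - Y)) (spread l Y F p) (grow F p)"
      using cl grow_guarded[OF reg, of "{}" F p] E l
      by (fastforce simp: clean_def spread_def valid_lengths_def)
    then show ?thesis using reach.guard[OF r forget.hyps(2,3)] n by blast
  qed
  then show ?case using l0 by blast
next
  case (join X E1 W1 E2 W2)
  note reg1 = elim_region[OF join.hyps(1)]
  have reg: "region X (E1 \<union> E2) (W1 \<union> W2)" using elim_region elim.join join.hyps by blast
  obtain l2 T2 where l2: "\<forall>e\<in>E2. N \<le> l2 e \<and> 2 \<le> l2 e \<and> l2 (prod.swap e) = l2 e"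
    and T2: "\<And>l c. valid_lengths l \<Longrightarrow> \<forall>e\<in>E2. l e = l2 e \<Longrightarrow>
      \<exists>n F p. n \<le> T2 \<and> reach l E2 n c F p \<and> clean X E2 W2 F p"
    using join.IH(2)[of N] by metis
  define S where "S = {e \<in> E1. fst e \<in> X}"
  define M where "M = 2 ^ card S * T2"
  \<comment> \<open>\<open>T2 + 2\<close> keeps contamination from crossing an arc of
    \<open>E1\<close> while \<open>E2\<close> is cleaned, \<open>M\<close> leaves room for the
    doubling in the later sweeps, and \<open>N\<close> is the bound imposed from outside.\<close>
  obtain l1 T1 where l1: "\<forall>e\<in>E1. N + M + T2 + 2 \<le> l1 e \<and> 2 \<le> l1 e \<and> l1 (prod.swap e) = l1 e"
    and T1: "\<And>l c. valid_lengths l \<Longrightarrow> \<forall>e\<in>E1. l e = l1 e \<Longrightarrow>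
      \<exists>n F p. n \<le> T1 \<and> reach l E1 n c F p \<and> clean X E1 W1 F p"
    using join.IH(1)[of "N + M + T2 + 2"] by metis
  define l0 where "l0 = (\<lambda>e. if e \<in> E1 then l1 e else l2 e)"
  have swap1: "prod.swap e \<in> E1 \<longleftrightarrow> e \<in> E1" for e
    using reg1 unfolding region_def by (metis swap_swap)
  have "\<forall>e\<in>E1 \<union> E2. N \<le> l0 e \<and> 2 \<le> l0 e \<and> l0 (prod.swap e) = l0 e"
    using l1 l2 swap1 by (auto simp: l0_def)
  moreover have "\<exists>n F p. n \<le> T1 + T2 + M \<and> reach l (E1 \<union> E2) n c F p \<and>
      clean X (E1 \<union> E2) (W1 \<union> W2) F p"
    if l: "valid_lengths l" and len: "\<forall>e\<in>E1 \<union> E2. l e = l0 e" for l c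
  proof -
    have len1: "\<forall>e\<in>E1. l e = l1 e" and len2: "\<forall>e\<in>E2. l e = l2 e"
      using len join.hyps(3) by (auto simp: l0_def)
    obtain n1 F1 p1 where n1: "n1 \<le> T1" and r1: "reach l E1 n1 c F1 p1" and c1: "clean X E1 W1 F1 p1"
      using T1[OF l len1] by blast
    obtain n2 F2 p2 where n2: "n2 \<le> T2" and r2: "reach l E2 n2 (F1, p1) F2 p2"
      and c2: "clean X E2 W2 F2 p2"
      using T2[OF l len2] by blast
    have "Suc n2 < l e" if "e \<in> E1" for e
      using l1 len1 n2 that by fastforce
    then have d: "F2 \<inter> (W1 - X) = {}" "\<forall>e\<in>E1. p2 e \<le> n2 \<and> (fst e \<notin> X \<longrightarrow> p2 e = 0)"
      using reach_decay[OF r2 refl reg1 l join.hyps(3) c1] by blast+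
    have c: "clean X (E1 \<union> E2 - S) (W1 \<union> W2) F2 p2"
      using d c2 by (auto simp: clean_def S_def)
    have "finite S" "S \<subseteq> E1 \<union> E2" using region_finite[OF reg1] by (auto simp: S_def)
    moreover have "p2 e \<le> T2" if "e \<in> S" for e using d that n2 by (auto simp: S_def)
    moreover have "2 ^ card S * T2 < l e" if "e \<in> S" for e
      using that l1 len1 M_def unfolding S_def by fastforce
    moreover have "fst e \<in> X" if "e \<in> S" for e using that by (simp add: S_def)
    ultimately obtain n F p where n: "n + T2 \<le> M" and r: "reach l (E1 \<union> E2) n (F2, p2) F p"
      and c: "clean X (E1 \<union> E2) (W1 \<union> W2) F p"
      using sweep_arcs[OF reg l, of S F2 p2 T2 "E1 \<union> E2"] c unfolding M_def by blast
    have "reach l (E1 \<union> E2) (n1 + n2 + n) c F p"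
      by (rule reach_trans[OF r reach_trans[OF reach_mono[OF r2] reach_mono[OF r1]]]) auto
    moreover have "n1 + n2 + n \<le> T1 + T2 + M" using n1 n2 n by linarith
    ultimately show ?thesis using c by blast
  qed
  ultimately show ?case by blast
qed

end

section \<open>Realisation in a subdivision\<close>

definition robber_step :: "'b pair_pre_digraph \<Rightarrow> 'b set \<Rightarrow> 'b set \<Rightarrow> 'b set" where
  "robber_step G S C = {u \<in> pverts G - C. u \<in> S \<or> (\<exists>a\<in>S. (a, u) \<in> parcs G)}"

lemma robber_step_mono: "S \<subseteq> S' \<Longrightarrow> robber_step G S C \<subseteq> robber_step G S' C"
  by (auto simp: robber_step_def)

lemma foldl_robber_step_mono:
  "S \<subseteq> S' \<Longrightarrow> foldl (robber_step G) S Cs \<subseteq> foldl (robber_step G) S' Cs"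
  by (induction Cs arbitrary: S S') (auto simp: robber_step_mono)

text \<open>A move of length at most 1 starts outside \<open>Cs ! i\<close> and ends outside
  \<open>Cs ! Suc i\<close>, so ignoring the vertices blocked during the move loses nothing.
  Starting from all of \<open>pverts G\<close> makes the first round an ordinary one.\<close>

lemma robber_territory_le:
  "i < length Cs \<Longrightarrow>
    robber_territory 1 G Cs i \<subseteq> foldl (robber_step G) (pverts G) (take (Suc i) Cs)"
proof (induction i)
  case 0
  then show ?case by (cases Cs) (auto simp: robber_step_def)
next
  case (Suc i)
  let ?R = "robber_territory 1 G Cs i"
  have "u \<in> ?R \<or> (hd p, u) \<in> parcs G"
    if "hd p \<in> ?R" "vpath p (with_proj G \<restriction> Y)" "last p = u" "vwalk_length p \<le> 1" for u p Y
  proof -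
    have "p \<noteq> []" using that by (auto simp: vpath_def vwalk_def)
    moreover have "length p \<le> 2" using that by simp
    ultimately consider "p = [u]" | a where "p = [a, u]"
      using \<open>last p = u\<close> by (cases p; cases "tl p") auto
    then show ?thesis
      using that by cases (auto simp: vpath_def vwalk_def)
  qed
  then have "robber_territory 1 G Cs (Suc i) \<subseteq> robber_step G ?R (Cs ! Suc i)"
    unfolding robber_territory.simps robber_step_def by blast
  also have "\<dots> \<subseteq> foldl (robber_step G) (pverts G) (take (Suc (Suc i)) Cs)"
    using Suc robber_step_mono[OF Suc.IH] by (simp add: take_Suc_conv_app_nth)
  finally show ?case .
qed

lemma blind_cop_width_le:
  assumes "Cs \<noteq> []" and "\<forall>C\<in>set Cs. C \<subseteq> pverts G \<and> card C \<le> m"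
    and "foldl (robber_step G) (pverts G) Cs = {}"
  shows "blind_cop_width 1 G \<le> m"
proof -
  have "robber_territory 1 G Cs (length Cs - 1) = {}"
    using robber_territory_le[of "length Cs - 1" Cs G] assms(1,3) by (cases Cs) auto
  then have "winning_blind_strategy 1 G Cs"
    using assms by (auto simp: winning_blind_strategy_def)
  then have "blind_cop_width 1 G \<le> Max (card ` set Cs)"
    unfolding blind_cop_width_def by (intro Least_le) blast
  also have "\<dots> \<le> m" using assms by simp
  finally show ?thesis .
qed

section \<open>A concrete subdivision on the natural numbers\<close>

locale subdivided_game = cop_game +
  fixes g :: "'a \<Rightarrow> nat" and l :: "'a \<times> 'a \<Rightarrow> nat"
  assumes inj_g: "inj_on g V" and lengths: "valid_lengths l"
begin

text \<open>Parity keeps branch vertices (even) apart from inner vertices (odd).\<close>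

definition branch :: "'a \<Rightarrow> nat" where
  "branch v = 2 * g v"

definition inner :: "'a \<Rightarrow> 'a \<Rightarrow> nat \<Rightarrow> nat" where
  "inner u v i = Suc (2 * prod_encode (g u, prod_encode (g v, i)))"

text \<open>Both orientations of an edge must name the same vertices, so inner ones are always
  numbered from the end with the smaller \<open>g\<close>.\<close>

definition pos :: "'a \<times> 'a \<Rightarrow> nat \<Rightarrow> nat" where
  "pos e i = (if i = 0 then branch (fst e) else if l e \<le> i then branch (snd e)
    else if g (fst e) < g (snd e) then inner (fst e) (snd e) i
    else inner (snd e) (fst e) (l e - i))"

definition H :: "nat pair_pre_digraph" where
  "H = \<lparr>pverts = branch ` V \<union> {pos e i |e i. e \<in> A \<and> 0 < i \<and> i < l e},
        parcs = {(pos e i, pos e (Suc i)) |e i. e \<in> A \<and> i < l e}\<rparr>"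

lemma length_ge_2: "e \<in> A \<Longrightarrow> 2 \<le> l e"
  and length_swap: "e \<in> A \<Longrightarrow> l (prod.swap e) = l e"
  using lengths by (auto simp: valid_lengths_def)

lemma arc_ends: "e \<in> A \<Longrightarrow> fst e \<in> V" "e \<in> A \<Longrightarrow> snd e \<in> V"
  using arcs_in_V by auto

lemma g_eq_iff: "u \<in> V \<Longrightarrow> v \<in> V \<Longrightarrow> g u = g v \<longleftrightarrow> u = v"
  using inj_g by (auto simp: inj_on_def)

lemma g_ends_neq: "e \<in> A \<Longrightarrow> g (fst e) \<noteq> g (snd e)"
  using arcs_irrefl g_eq_iff arc_ends by (metis prod.collapse)

lemma branch_eq_iff: "u \<in> V \<Longrightarrow> v \<in> V \<Longrightarrow> branch u = branch v \<longleftrightarrow> u = v"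
  by (simp add: branch_def g_eq_iff)

lemma inner_neq_branch: "inner u v i \<noteq> branch w"
  unfolding inner_def branch_def by presburger

lemma inner_eq_iff: "inner u v i = inner u' v' i' \<longleftrightarrow> g u = g u' \<and> g v = g v' \<and> i = i'"
  by (simp add: inner_def)

lemma pos_0: "pos e 0 = branch (fst e)"
  by (simp add: pos_def)

lemma pos_length: "e \<in> A \<Longrightarrow> pos e (l e) = branch (snd e)"
  using length_ge_2[of e] by (simp add: pos_def)

lemma pos_swap:
  assumes "e \<in> A" "i \<le> l e"
  shows "pos (prod.swap e) i = pos e (l e - i)"
  using assms length_ge_2[of e] length_swap[of e] g_ends_neq[of e] by (auto simp: pos_def)

lemma pos_eq_branch:
  assumes "e \<in> A" "i \<le> l e" "v \<in> V" "pos e i = branch v"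
  shows "i = 0 \<and> fst e = v \<or> i = l e \<and> snd e = v"
  using assms arc_ends[of e]
  by (auto simp: pos_def branch_eq_iff inner_neq_branch split: if_splits)

text \<open>Injectivity of \<open>g\<close> and \<open>prod_encode\<close> recovers edge and
  position from an inner vertex; only the orientation stays open.\<close>

lemma pos_eq_pos:
  assumes e: "e \<in> A" "0 < i" "i < l e" and e': "e' \<in> A" "i' \<le> l e'" and eq: "pos e' i' = pos e i"
  shows "e' = e \<and> i' = i \<or> e' = prod.swap e \<and> i' = l e - i"
proof -
  have "pos e' i' \<noteq> branch v" for v
    using e eq by (simp add: pos_def inner_neq_branch)
  then have i': "0 < i'" "i' < l e'"
    using pos_0[of e'] pos_length[OF e'(1)] e'(2) by (metis gr0I, metis le_neq_implies_less)
  obtain u v u' v' where uv: "e = (u, v)" "e' = (u', v')" by fastforce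
  have V: "u \<in> V" "v \<in> V" "u' \<in> V" "v' \<in> V" using uv e e' arc_ends by fastforce+
  show ?thesis
    using eq e i' V g_ends_neq[OF e(1)] g_ends_neq[OF e'(1)] length_swap[OF e(1)] unfolding uv
    by (auto simp: pos_def inner_eq_iff g_eq_iff split: if_splits)
qed

lemma pos_in_H:
  assumes "e \<in> A" "i \<le> l e"
  shows "pos e i \<in> pverts H"
proof -
  consider "i = 0" | "i = l e" | "0 < i" "i < l e" using assms(2) by linarith
  then show ?thesis
  proof cases
    case 3
    then show ?thesis using assms(1) unfolding H_def pair_pre_digraph.simps by blast
  qed (use assms(1) pos_0 pos_length arc_ends in \<open>simp_all add: H_def\<close>)
qed

lemma branch_in_H: "v \<in> V \<Longrightarrow> branch v \<in> pverts H"
  by (simp add: H_def)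

section \<open>Simulation of the abstract search\<close>

definition dirty :: "'a set \<Rightarrow> ('a \<times> 'a \<Rightarrow> nat) \<Rightarrow> nat set" where
  "dirty F p = branch ` (F \<inter> V) \<union> {pos e i |e i. e \<in> A \<and> 0 < i \<and> i < l e \<and> i \<le> p e}"

lemma dirty_branch: "v \<in> F \<Longrightarrow> v \<in> V \<Longrightarrow> branch v \<in> dirty F p"
  by (auto simp: dirty_def)

lemma dirty_pos: "e \<in> A \<Longrightarrow> 0 < i \<Longrightarrow> i < l e \<Longrightarrow> i \<le> p e \<Longrightarrow> pos e i \<in> dirty F p"
  unfolding dirty_def by blast

lemma dirty_cases:
  assumes "x \<in> dirty F p"
  obtains v where "v \<in> F" "v \<in> V" "x = branch v"
  | e i where "e \<in> A" "0 < i" "i < l e" "i \<le> p e" "x = pos e i"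
  using assms by (auto simp: dirty_def)

text \<open>A moving robber enters a branch vertex from position \<open>1\<close> or
  \<open>l e - 1\<close> of an arc, which \<open>spread\<close> records, or shifts to an inner
  position, which \<open>grow\<close> covers.\<close>

lemma robber_step_dirty:
  assumes C: "branch ` X \<subseteq> C"
  shows "robber_step H (dirty F p) C \<subseteq> dirty (spread l X F p) (grow F p)"
proof
  fix y assume y: "y \<in> robber_step H (dirty F p) C"
  have B: "y \<in> dirty (spread l X F p) (grow F p)"
    if "y = branch v" "v \<in> V" "v \<notin> X \<Longrightarrow> v \<in> spread l X F p" for v
    using that y C by (intro dirty_branch[of v, folded that(1)]) (auto simp: robber_step_def)
  have P: "y \<in> dirty (spread l X F p) (grow F p)"
    if "y = pos e i" "e \<in> A" "0 < i" "i < l e" "i \<le> Suc (p e)" "0 < p e \<or> fst e \<in> F" for e i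
    using that dirty_pos[of e i "grow F p"] by (auto simp: grow_def split: if_splits)
  consider "y \<in> dirty F p" | e i where "e \<in> A" "i < l e" "pos e i \<in> dirty F p" "y = pos e (Suc i)"
    using y by (auto simp: robber_step_def H_def)
  then show "y \<in> dirty (spread l X F p) (grow F p)"
  proof cases
    case 1
    then show ?thesis
    proof (cases rule: dirty_cases)
      case (1 v)
      then show ?thesis by (intro B[of v]) (auto simp: spread_def)
    next
      case (2 e i)
      then show ?thesis by (intro P[of e i]) auto
    qed
  next
    case (2 e i)
    note ei = 2
    from ei(3) show ?thesis
    proof (cases rule: dirty_cases)
      case (1 v)
      then have "i = 0" "fst e = v" using pos_eq_branch[of e i v] ei by auto
      \<comment> \<open>Lengths are at least 2, so a robber leaving a branch vertex lands on an
        inner one; hence \<open>spread\<close> needs no rule between adjacent branch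
        vertices.\<close>
      then show ?thesis using ei 1 length_ge_2[of e] by (intro P[of e "Suc i"]) auto
    next
      case (2 a j)
      from pos_eq_pos[OF 2(1-3) ei(1) _ 2(5)] ei(2)
      consider "e = a" "i = j" | "e = prod.swap a" "i = l a - j" by auto
      then show ?thesis
      proof cases
        case 1
        show ?thesis
        proof (cases "Suc i = l e")
          case True
          then have "l e \<le> Suc (p e)" using 1 2 by simp
          then show ?thesis using True ei pos_length[of e] arc_ends[of e]
            by (intro B[of "snd e"]) (simp, simp, unfold spread_def, blast)
        next
          case False
          then show ?thesis using ei 1 2 by (intro P[of e "Suc i"]) auto
        qed
      next
        case c: 2
        \<comment> \<open>The robber walks back along \<open>a\<close>: position
          \<open>i + 1\<close> on the reversed arc is position \<open>j - 1\<close> on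
          \<open>a\<close>.\<close>
        have "Suc i = l a - (j - 1)" using c 2 by auto
        then have y': "y = pos a (j - 1)"
          using ei(4) c(1) pos_swap[of a "l a - (j - 1)"] 2(1,3) by simp
        show ?thesis
        proof (cases "j = 1")
          case True
          then have "0 < p a" using 2 by simp
          then show ?thesis using True y' 2(1) pos_0[of a] arc_ends[of a]
            by (intro B[of "fst a"]) (simp, simp, unfold spread_def, blast)
        next
          case False
          then show ?thesis using y' 2 by (intro P[of a "j - 1"]) auto
        qed
      qed
    qed
  qed
qed

text \<open>In one round the segment bounded by \<open>p e\<close> reaches at most
  \<open>p e + 1\<close>, and the two cops occupy exactly the last two positions.\<close>

lemma robber_step_sweep:
  assumes C: "branch ` X \<subseteq> C" "pos e (p e) \<in> C" "pos e (Suc (p e)) \<in> C" and e: "0 < p e"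
  shows "robber_step H (dirty F p) C \<subseteq> dirty (spread l X F p) ((grow F p)(e := p e - 1))"
proof
  fix y assume y: "y \<in> robber_step H (dirty F p) C"
  then have "y \<notin> C" by (simp add: robber_step_def)
  have "y \<in> dirty (spread l X F p) (grow F p)" using y robber_step_dirty[OF C(1)] by blast
  then show "y \<in> dirty (spread l X F p) ((grow F p)(e := p e - 1))"
  proof (cases rule: dirty_cases)
    case (1 v)
    then show ?thesis using dirty_branch by blast
  next
    case (2 a i)
    have "i \<le> p a - 1" if "a = e"
    proof -
      have "i \<noteq> p e" "i \<noteq> Suc (p e)" using \<open>y \<notin> C\<close> C 2(5) that by auto
      then show ?thesis using 2(4) that e by (simp add: grow_def split: if_splits)
    qed
    then show ?thesis using 2 unfolding 2(5) by (intro dirty_pos) auto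
  qed
qed

lemma dirty_refill:
  assumes e: "e \<in> A"
  shows "dirty F p \<subseteq> dirty F (p(e := l e - 1, prod.swap e := 0))"
proof
  fix x assume "x \<in> dirty F p"
  then show "x \<in> dirty F (p(e := l e - 1, prod.swap e := 0))"
  proof (cases rule: dirty_cases)
    case (1 v)
    then show ?thesis using dirty_branch by blast
  next
    case (2 a i)
    have ne: "e \<noteq> prod.swap e" using e arcs_irrefl by (metis prod.collapse fst_swap)
    consider "a = e" | "a = prod.swap e" | "a \<noteq> e" "a \<noteq> prod.swap e" by blast
    then show ?thesis
    proof cases
      case 1
      then show ?thesis using 2 ne unfolding 2(5) by (intro dirty_pos) auto
    next
      case c: 2
      then have "x = pos e (l e - i)" using 2 pos_swap[OF e, of i] length_swap[OF e] by simp
      then show ?thesis using 2 c ne e length_swap[OF e] by (auto intro!: dirty_pos)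
    next
      case 3
      then show ?thesis using 2 unfolding 2(5) by (intro dirty_pos) auto
    qed
  qed
qed

lemma reach_play:
  assumes "reach l E n c F p"
  shows "\<exists>Cs. (\<forall>C\<in>set Cs. C \<subseteq> pverts H \<and> card C \<le> K + 2) \<and>
    foldl (robber_step H) (dirty (fst c) (snd c)) Cs \<subseteq> dirty F p"
  using assms
proof (induction rule: reach.induct)
  case (start F p)
  then show ?case by (intro exI[of _ "[]"]) simp
next
  case (guard n c F p X)
  then obtain Cs where Cs: "\<forall>C\<in>set Cs. C \<subseteq> pverts H \<and> card C \<le> K + 2"
    "foldl (robber_step H) (dirty (fst c) (snd c)) Cs \<subseteq> dirty F p" by blast
  have "finite X" using guard.hyps(2) finite_V finite_subset by blast
  then have "card (branch ` X) \<le> K" using guard.hyps(3) card_image_le le_trans by blast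
  moreover have "branch ` X \<subseteq> pverts H" using guard.hyps(2) branch_in_H by blast
  moreover have "foldl (robber_step H) (dirty (fst c) (snd c)) (Cs @ [branch ` X])
      \<subseteq> dirty (spread l X F p) (grow F p)"
    using robber_step_mono[OF Cs(2)] robber_step_dirty[of X "branch ` X" F p] by force
  ultimately show ?case using Cs(1) by (intro exI[of _ "Cs @ [branch ` X]"]) auto
next
  case (sweep n c F p X e)
  then obtain Cs where Cs: "\<forall>C\<in>set Cs. C \<subseteq> pverts H \<and> card C \<le> K + 2"
    "foldl (robber_step H) (dirty (fst c) (snd c)) Cs \<subseteq> dirty F p" by blast
  let ?C = "insert (pos e (p e)) (insert (pos e (Suc (p e))) (branch ` X))"
  have "finite X" using sweep.hyps(2) finite_V finite_subset by blast
  then have "card (branch ` X) \<le> K" using sweep.hyps(3) card_image_le le_trans by blast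
  then have "card ?C \<le> K + 2" using \<open>finite X\<close> by (auto simp: card_insert_if)
  moreover have "?C \<subseteq> pverts H" using sweep.hyps branch_in_H pos_in_H by auto
  moreover have "foldl (robber_step H) (dirty (fst c) (snd c)) (Cs @ [?C])
      \<subseteq> dirty (spread l X F p) ((grow F p)(e := p e - 1))"
    using order_trans[OF robber_step_mono[OF Cs(2)] robber_step_sweep[of X ?C e p F]] sweep.hyps
    by auto
  ultimately have "(\<forall>C\<in>set (Cs @ [?C]). C \<subseteq> pverts H \<and> card C \<le> K + 2) \<and>
      foldl (robber_step H) (dirty (fst c) (snd c)) (Cs @ [?C])
        \<subseteq> dirty (spread l X F p) ((grow F p)(e := p e - 1))"
    using Cs(1) by simp
  then show ?case by blast
next
  case (refill n c F p e)
  then show ?case using dirty_refill[of e F p] by blast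
qed

lemma blind_cop_width_H:
  assumes "reach l E n (V, l) F p" and "clean X A W F p" and "V \<subseteq> X \<union> W"
  shows "blind_cop_width 1 H \<le> K + 2"
proof -
  obtain Cs where Cs: "\<forall>C\<in>set Cs. C \<subseteq> pverts H \<and> card C \<le> K + 2"
    "foldl (robber_step H) (dirty V l) Cs \<subseteq> dirty F p"
    using reach_play[OF assms(1)] by auto
  have "dirty F p = {}" using assms(2,3) by (auto simp: dirty_def clean_def)
  \<comment> \<open>The bound \<open>l\<close> exceeds every inner position, so
    \<open>(V, l)\<close> stands for full contamination.\<close>
  moreover have "pverts H \<subseteq> dirty V l"
    unfolding H_def dirty_def by (auto intro: less_imp_le)
  ultimately have "foldl (robber_step H) (pverts H) Cs = {}"
    using Cs(2) foldl_robber_step_mono by blast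
  \<comment> \<open>The appended empty round makes the list nonempty; an empty territory stays
    empty.\<close>
  then show ?thesis
    using Cs(1) by (intro blind_cop_width_le[of "Cs @ [{}]"]) (auto simp: robber_step_def)
qed

section \<open>\<open>H\<close> is a graph and a subdivision\<close>

lemma pos_inj:
  assumes e: "e \<in> A" and i: "i \<le> l e" and j: "j \<le> l e" and eq: "pos e i = pos e j"
  shows "i = j"
proof -
  have ne: "fst e \<noteq> snd e" "e \<noteq> prod.swap e" using g_ends_neq[OF e] by (auto simp: prod_eq_iff)
  consider "i = 0" | "i = l e" | "0 < i" "i < l e" using i by linarith
  then show ?thesis
  proof cases
    case 1
    then show ?thesis using pos_eq_branch[OF e j, of "fst e"] eq pos_0 arc_ends[OF e] ne by auto
  next
    case 2
    then show ?thesis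
      using pos_eq_branch[OF e j, of "snd e"] eq pos_length[OF e] arc_ends[OF e] ne by auto
  next
    case 3
    then show ?thesis using pos_eq_pos[OF e 3 e j] eq ne by auto
  qed
qed

lemma pair_graph_H: "pair_graph H"
proof
  have arc: "\<exists>a i. a \<in> A \<and> i < l a \<and> e = (pos a i, pos a (Suc i))" if "e \<in> parcs H" for e
    using that by (auto simp: H_def)
  show ends: "fst e \<in> pverts H" "snd e \<in> pverts H" if "e \<in> parcs H" for e
    using arc[OF that] pos_in_H by auto
  have "{pos e i |e i. e \<in> A \<and> 0 < i \<and> i < l e} \<subseteq> (\<Union>e\<in>A. pos e ` {..<l e})"
    by blast
  then have "finite {pos e i |e i. e \<in> A \<and> 0 < i \<and> i < l e}"
    using finite_A finite_subset by blast
  then show fin: "finite (pverts H)" using finite_V by (simp add: H_def)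
  have "parcs H \<subseteq> pverts H \<times> pverts H" using ends by (auto simp: mem_Times_iff)
  then show "finite (parcs H)" using fin finite_subset by blast
  show "fst e \<noteq> snd e" if e: "e \<in> parcs H" for e
  proof -
    obtain a i where "a \<in> A" "i < l a" "e = (pos a i, pos a (Suc i))" using arc[OF e] by blast
    then show ?thesis using pos_inj[of a i "Suc i"] by auto
  qed
  have "(y, x) \<in> parcs H" if xy: "(x, y) \<in> parcs H" for x y
  proof -
    obtain a i where a: "a \<in> A" "i < l a" "x = pos a i" "y = pos a (Suc i)" using arc[OF xy] by auto
    define j where "j = l a - Suc i"
    have j: "j < l (prod.swap a)" "y = pos (prod.swap a) j" "x = pos (prod.swap a) (Suc j)"
      using a pos_swap[OF a(1), of j] pos_swap[OF a(1), of "Suc j"] length_swap[OF a(1)]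
      by (simp_all add: j_def Suc_diff_Suc)
    then show ?thesis using arcs_sym[OF a(1)] unfolding H_def pair_pre_digraph.simps by blast
  qed
  then show "symmetric H" by (auto simp: symmetric_def intro: symI)
qed

definition route :: "'a \<times> 'a \<Rightarrow> nat list" where
  "route e = map (pos e) [0..<Suc (l e)]"

lemma internal_verts_route: "e \<in> A \<Longrightarrow> internal_verts (route e) = {pos e i |i. 0 < i \<and> i < l e}"
proof -
  assume "e \<in> A"
  then have "[0..<Suc (l e)] = 0 # [1..<l e] @ [l e]"
    using length_ge_2[of e] upt_conv_Cons[of 0 "l e"] by simp
  then have "butlast (tl (route e)) = map (pos e) [1..<l e]"
    by (simp only: route_def list.map list.sel map_append butlast_snoc)
  then show ?thesis by (auto simp: internal_verts_def)
qed

lemma vwalk_arcs_map_upt: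
  "vwalk_arcs (map h [0..<Suc n]) = map (\<lambda>i. (h i, h (Suc i))) [0..<n]"
proof (induction n)
  case (Suc n)
  have "vwalk_arcs (map h [0..<Suc n] @ [h (Suc n)]) =
      vwalk_arcs (map h [0..<Suc n]) @ [(h n, h (Suc n))]"
    by (subst vwalk_arcs_append) auto
  then show ?case using Suc by simp
qed simp

lemma route_swap: "e \<in> A \<Longrightarrow> route (prod.swap e) = rev (route e)"
  using length_swap[of e] pos_swap[of e]
  by (intro nth_equalityI) (auto simp: route_def rev_nth simp del: upt_Suc)

lemma subdivision_of_H:
  assumes V: "pverts G = V" and A: "parcs G = A"
  shows "subdivision_of G H"
proof -
  have path: "vpath (route e) (with_proj H)" if e: "e \<in> A" for e
  proof -
    have "set (route e) \<subseteq> pverts H" using pos_in_H[OF e] by (auto simp: route_def)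
    moreover have "set (vwalk_arcs (route e)) \<subseteq> parcs H"
      unfolding route_def vwalk_arcs_map_upt H_def pair_pre_digraph.simps using e by fastforce
    moreover have "distinct (route e)"
      using pos_inj[OF e] by (auto simp: route_def distinct_map inj_on_def simp del: upt_Suc)
    ultimately show ?thesis by (auto simp: vpath_def vwalk_def route_def)
  qed
  have ends: "hd (route e) = branch (fst e)" "last (route e) = branch (snd e)" if "e \<in> A" for e
    using pos_0[of e] pos_length[OF that] by (simp_all add: route_def hd_map last_map del: upt_Suc)
  have "internal_verts (route e) \<inter> branch ` V = {}" if e: "e \<in> A" for e
    using pos_eq_branch[OF e] order_less_imp_le unfolding internal_verts_route[OF e] by blast
  moreover have "internal_verts (route (u, v)) \<inter> internal_verts (route (x, y)) = {}"
    if e: "(u, v) \<in> A" "(x, y) \<in> A" and ne: "{u, v} \<noteq> {x, y}" for u v x y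
  proof (rule equals0I)
    fix z assume "z \<in> internal_verts (route (u, v)) \<inter> internal_verts (route (x, y))"
    then obtain i j where i: "0 < i" "i < l (u, v)" and z: "z = pos (u, v) i"
      and j: "j < l (x, y)" "z = pos (x, y) j"
      unfolding internal_verts_route[OF e(1)] internal_verts_route[OF e(2)] by blast
    show False using pos_eq_pos[OF e(1) i e(2), of j] z j ne by auto
  qed
  moreover have "route (v, u) = rev (route (u, v))" if "(u, v) \<in> A" for u v
    using route_swap[OF that] by simp
  moreover have "vwalk_length (route e) \<noteq> 0" if "e \<in> A" for e
    using length_ge_2[OF that] by (simp add: route_def)
  moreover have "pverts H = branch ` V \<union> (\<Union>e\<in>A. internal_verts (route e))"
    unfolding H_def pair_pre_digraph.simps using internal_verts_route by blast
  moreover have "parcs H = (\<Union>e\<in>A. set (vwalk_arcs (route e)))"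
    unfolding route_def vwalk_arcs_map_upt H_def pair_pre_digraph.simps set_map set_upt by fastforce
  moreover have "inj_on branch V" using branch_eq_iff by (auto simp: inj_on_def)
  ultimately show ?thesis
    unfolding subdivision_of_def V A using path ends
    by (intro exI[of _ branch] exI[of _ route] conjI ballI case_prodI2 impI) simp_all
qed

end

section \<open>Tree decompositions\<close>

text \<open>Elimination needs only this order, not the tree: when bags are removed in reverse,
  whatever \<open>s\<close> shares with the remaining bags survives in \<open>t\<close>.\<close>

inductive running_intersection :: "('t \<Rightarrow> 'a set) \<Rightarrow> 't set \<Rightarrow> bool" for B where
  single: "running_intersection B {r}"
| extend: "running_intersection B S \<Longrightarrow> t \<in> S \<Longrightarrow> s \<notin> S \<Longrightarrow> B s \<inter> (\<Union>r\<in>S. B r) \<subseteq> B t \<Longrightarrow>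
    running_intersection B (insert s S)"

definition simple_path :: "('t \<times> 't) set \<Rightarrow> 't set \<Rightarrow> 't list \<Rightarrow> bool" where
  "simple_path R S p \<longleftrightarrow> p \<noteq> [] \<and> set p \<subseteq> S \<and> set (vwalk_arcs p) \<subseteq> R \<and> distinct p"

lemma connected_simple_path:
  assumes "connected D" and "wf_digraph D" and "symmetric D" and "x \<in> verts D" and "y \<in> verts D"
  shows "\<exists>p. simple_path (arcs_ends D) (verts D) p \<and> hd p = x \<and> last p = y"
proof -
  interpret D: wf_digraph D by fact
  have "x \<rightarrow>\<^sup>*\<^bsub>D\<^esub> y"
    using assms D.reachable_mk_symmetric_eq by (auto simp: connected_def strongly_connected_def)
  then obtain p where "vpath p D" "hd p = x" "last p = y"
    using D.reachable_vwalk_conv vwalk_imp_ex_vpath by metis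
  then show ?thesis by (auto simp: simple_path_def vpath_def vwalk_def)
qed

text \<open>A largest connected node set \<open>S\<close> with such an order is the whole tree.
  Otherwise some arc leaves \<open>S\<close> from \<open>t\<close> to \<open>s\<close>, and a vertex
  shared by \<open>B s\<close> and a bag in \<open>S\<close> but missing from \<open>B t\<close>
  gives a second route from \<open>s\<close> into \<open>S\<close>, hence a cycle.\<close>

lemma running_intersection_of_tree:
  assumes tree: "undirected_tree T"
    and conn: "\<And>v. v \<in> (\<Union>t\<in>pverts T. B t) \<Longrightarrow> connected (with_proj T \<restriction> {t \<in> pverts T. v \<in> B t})"
  shows "running_intersection B (pverts T)"
proof -
  let ?R = "parcs T"
  interpret pair_graph T using tree by (simp add: undirected_tree_def)
  have acyclic: "\<not> (simple_path ?R (pverts T) p \<and> 3 \<le> length p \<and> (last p, hd p) \<in> ?R)" for p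
    using tree by (auto simp: undirected_tree_def simple_path_def vpath_def vwalk_def)
  have symR: "(y, x) \<in> ?R" if "(x, y) \<in> ?R" for x y
    using pair_sym_arcs that by (auto simp: symmetric_def dest: symD)
  have pathT: "\<exists>p. simple_path ?R (pverts T) p \<and> hd p = x \<and> last p = y"
    if "x \<in> pverts T" "y \<in> pverts T" for x y
    using connected_simple_path[of "with_proj T" x y] that tree pair_sym_arcs wf_digraph_axioms
    by (simp add: undirected_tree_def)
  have pathB: "\<exists>p. simple_path ?R {t \<in> pverts T. v \<in> B t} p \<and> hd p = x \<and> last p = y"
    if xy: "x \<in> pverts T" "y \<in> pverts T" "v \<in> B x" "v \<in> B y" for v x y
  proof -
    let ?S = "{t \<in> pverts T. v \<in> B t}"
    let ?D = "with_proj T \<restriction> ?S"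
    have ends: "arcs_ends ?D = ?R \<inter> ?S \<times> ?S"
      by (auto simp: arcs_ends_def arc_to_ends_def)
    have "connected ?D" using conn xy by blast
    moreover have "wf_digraph ?D" by (rule wellformed_induce_subgraph)
    moreover have "symmetric ?D" using symR ends by (auto simp: symmetric_def intro: symI)
    ultimately obtain p where "simple_path (arcs_ends ?D) ?S p" "hd p = x" "last p = y"
      using connected_simple_path[of ?D x y] xy by auto
    then show ?thesis using ends by (auto simp: simple_path_def)
  qed
  \<comment> \<open>Connectedness of \<open>S\<close> itself lets the cycle return inside
    \<open>S\<close>, disjoint from the part of the route that runs outside.\<close>
  define linked where "linked S \<longleftrightarrow>
    (\<forall>x\<in>S. \<forall>y\<in>S. \<exists>p. simple_path ?R S p \<and> hd p = x \<and> last p = y)" for S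
  define Q where "Q S \<longleftrightarrow> S \<subseteq> pverts T \<and> S \<noteq> {} \<and> running_intersection B S \<and> linked S" for S
  have grow: "\<exists>s. s \<notin> S \<and> Q (insert s S)" if Q: "Q S" and ne: "S \<noteq> pverts T" for S
  proof -
    obtain r y where "r \<in> S" "y \<in> pverts T" "y \<notin> S" using Q ne unfolding Q_def by blast
    then obtain p where p: "simple_path ?R (pverts T) p" "hd p = r" "last p = y"
      using pathT Q unfolding Q_def by blast
    then have "\<exists>x\<in>set p. x \<notin> S" using \<open>y \<notin> S\<close> by (metis last_in_set simple_path_def)
    then obtain p1 s p2 where p12: "p = p1 @ s # p2" "s \<notin> S" "\<forall>x\<in>set p1. x \<in> S"
      using split_list_first_prop[of p "\<lambda>x. x \<notin> S"] by blast
    have "p1 \<noteq> []" using p(2) p12 \<open>r \<in> S\<close> by auto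
    define t where "t = last p1"
    have tS: "t \<in> S" using p12 \<open>p1 \<noteq> []\<close> by (simp add: t_def)
    have ts: "(t, s) \<in> ?R"
      using p(1) \<open>p1 \<noteq> []\<close> by (simp add: simple_path_def p12 vwalk_arcs_append t_def)
    have sT: "s \<in> pverts T" using p(1) by (simp add: simple_path_def p12)
    have "v \<in> B t" if v: "v \<in> B s" "v \<in> B s'" "s' \<in> S" for v s'
    proof (rule ccontr)
      assume "v \<notin> B t"
      obtain q where q: "simple_path ?R {t \<in> pverts T. v \<in> B t} q" "hd q = s" "last q = s'"
        using pathB[of s s' v] v sT Q unfolding Q_def by blast
      then have "\<exists>x\<in>set q. x \<in> S" using \<open>s' \<in> S\<close> by (metis last_in_set simple_path_def)
      then obtain q1 x q2 where q12: "q = q1 @ x # q2" "x \<in> S" "\<forall>z\<in>set q1. z \<notin> S"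
        using split_list_first_prop[of q "\<lambda>x. x \<in> S"] by blast
      have "q1 \<noteq> []" using q(2) q12 \<open>s \<notin> S\<close> by auto
      \<comment> \<open>This excludes a return along the arc between \<open>s\<close> and
        \<open>t\<close>, which would close no cycle.\<close>
      have "x \<noteq> t" using q(1) q12 \<open>v \<notin> B t\<close> by (auto simp: simple_path_def)
      obtain c where c: "simple_path ?R S c" "hd c = x" "last c = t"
        using Q \<open>x \<in> S\<close> tS unfolding Q_def linked_def by blast
      have "2 \<le> length c" using c \<open>x \<noteq> t\<close>
        by (cases c; cases "tl c") (auto simp: simple_path_def)
      moreover have "1 \<le> length q1" using \<open>q1 \<noteq> []\<close> by (cases q1) auto
      ultimately have "3 \<le> length (q1 @ c)" by simp
      moreover have "simple_path ?R (pverts T) (q1 @ c)"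
        using q(1) c q12 \<open>q1 \<noteq> []\<close> Q
        by (auto simp: simple_path_def vwalk_arcs_append Q_def)
      moreover have "hd (q1 @ c) = s" "last (q1 @ c) = t"
        using q(2) q12 \<open>q1 \<noteq> []\<close> c by (auto simp: simple_path_def)
      \<comment> \<open>\<open>q1 @ c\<close> leaves \<open>S\<close> at \<open>s\<close>, returns at \<open>x\<close> and runs inside \<open>S\<close> to \<open>t\<close>, closing a cycle.\<close>
      ultimately show False using acyclic[of "q1 @ c"] ts by simp
    qed
    then have "running_intersection B (insert s S)"
      using Q tS \<open>s \<notin> S\<close> by (intro running_intersection.extend[of B S t s]) (auto simp: Q_def)
    moreover have "linked (insert s S)"
      unfolding linked_def
    proof (intro ballI)
      fix x y assume x: "x \<in> insert s S" and y: "y \<in> insert s S"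
      have P: "\<exists>p. simple_path ?R S p \<and> hd p = a \<and> last p = b" if "a \<in> S" "b \<in> S" for a b
        using Q that by (auto simp: Q_def linked_def)
      consider "x = s" "y = s" | "x = s" "y \<in> S" | "x \<in> S" "y = s" | "x \<in> S" "y \<in> S"
        using x y by blast
      then show "\<exists>p. simple_path ?R (insert s S) p \<and> hd p = x \<and> last p = y"
      proof cases
        case 1
        then show ?thesis by (intro exI[of _ "[s]"]) (simp add: simple_path_def)
      next
        case 2
        then obtain p where "simple_path ?R S p" "hd p = t" "last p = y" using P tS by blast
        then show ?thesis using 2 symR[OF ts] \<open>s \<notin> S\<close>
          by (intro exI[of _ "s # p"]) (auto simp: simple_path_def)
      next
        case 3
        then obtain p where "simple_path ?R S p" "hd p = x" "last p = t" using P tS by blast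
        then show ?thesis using 3 ts \<open>s \<notin> S\<close>
          by (intro exI[of _ "p @ [s]"]) (auto simp: simple_path_def vwalk_arcs_append)
      next
        case 4
        then show ?thesis using P[of x y] by (auto simp: simple_path_def)
      qed
    qed
    ultimately show ?thesis using Q sT \<open>s \<notin> S\<close> by (auto simp: Q_def)
  qed
  have card: "card S \<le> card (pverts T)" if "Q S" for S
    using that pair_finite_verts by (auto simp: Q_def card_mono)
  obtain r where "r \<in> pverts T"
    using tree by (auto simp: undirected_tree_def connected_def strongly_connected_def)
  then have "Q {r}"
    unfolding Q_def linked_def
    by (auto intro!: running_intersection.single exI[of _ "[r]"] simp: simple_path_def)
  then obtain S where S: "Q S" "\<And>S'. Q S' \<Longrightarrow> card S' \<le> card S"
    using ex_has_greatest_nat[of Q "{r}" card "Suc (card (pverts T))"] card le_imp_less_Suc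
    by blast
  have "S = pverts T"
  proof (rule ccontr)
    assume "S \<noteq> pverts T"
    then obtain s where "s \<notin> S" "Q (insert s S)" using grow[OF S(1)] by blast
    moreover have "finite S" using S(1) finite_subset[OF _ pair_finite_verts] unfolding Q_def by blast
    ultimately show False using S(2) by fastforce
  qed
  then show ?thesis using S(1) by (simp add: Q_def)
qed

section \<open>Elimination along the insertion order\<close>

context cop_game
begin

text \<open>Each edge inside a bag acts as a child of its own, attached by \<open>join\<close>, and
  so gets its own length. The induction is over proper subsets because both arcs of an edge leave
  \<open>D\<close> at once.\<close>

lemma elim_add_arcs:
  assumes "elim X E W" and "finite D" and "D \<subseteq> A" and "\<And>e. e \<in> D \<Longrightarrow> prod.swap e \<in> D"
    and "D \<inter> E = {}" and "D \<subseteq> X \<times> X"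
  shows "elim X (E \<union> D) W"
  using assms(2-)
proof (induction D rule: finite_psubset_induct)
  case (psubset D)
  show ?case
  proof (cases "D = {}")
    case True
    then show ?thesis using assms(1) by simp
  next
    case False
    then obtain u v where uv: "(u, v) \<in> D" by auto
    then have vu: "(v, u) \<in> D" using psubset.prems(2)[OF uv] by simp
    let ?D = "D - {(u, v), (v, u)}"
    have "prod.swap e \<in> ?D" if "e \<in> ?D" for e
      using that psubset.prems(2)[of e] by (cases e) auto
    moreover have "?D \<subset> D" "?D \<subseteq> A" "?D \<inter> E = {}" "?D \<subseteq> X \<times> X" using psubset.prems uv by blast+
    ultimately have el: "elim X (E \<union> ?D) W" by (intro psubset.IH)
    have "elim X {(u, v), (v, u)} {}"
      using elim_region[OF assms(1)] uv psubset.prems by (intro elim.edge) (auto simp: region_def)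
    moreover have "(E \<union> ?D) \<inter> {(u, v), (v, u)} = {}" using psubset.prems(3) uv vu by auto
    ultimately have "elim X (E \<union> ?D \<union> {(u, v), (v, u)}) (W \<union> {})" using el by (intro elim.join)
    moreover have "E \<union> ?D \<union> {(u, v), (v, u)} = E \<union> D" using uv vu by auto
    ultimately show ?thesis by simp
  qed
qed

text \<open>
  The bags are merged into their parents in reverse order of insertion; \<open>E t\<close> and \<open>W t\<close> record what
  has been merged into \<open>t\<close> so far.
\<close>

lemma elim_of_running_intersection:
  assumes "running_intersection B S"
    and "\<And>t. t \<in> S \<Longrightarrow> elim (B t) (E t) (W t)"
    and "\<And>s t. s \<in> S \<Longrightarrow> t \<in> S \<Longrightarrow> s \<noteq> t \<Longrightarrow> E s \<inter> E t = {}"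
    and "\<And>s t. s \<in> S \<Longrightarrow> t \<in> S \<Longrightarrow> W s \<inter> B t = {}"
    and "\<And>e. e \<in> A \<Longrightarrow> (\<forall>t\<in>S. e \<notin> E t) \<Longrightarrow> \<exists>t\<in>S. e \<in> B t \<times> B t"
    and "V \<subseteq> (\<Union>t\<in>S. B t \<union> W t)"
  shows "\<exists>X W'. elim X A W' \<and> V \<subseteq> X \<union> W'"
  using assms
proof (induction arbitrary: E W rule: running_intersection.induct)
  case (single r)
  have el: "elim (B r) (E r) (W r)" using single.prems(1) by simp
  note reg = elim_region[OF el]
  have sw: "prod.swap e \<in> E r \<longleftrightarrow> e \<in> E r" for e
    using reg unfolding region_def by (metis swap_swap)
  have "elim (B r) (E r \<union> (A - E r)) (W r)"
    using elim_add_arcs[OF el, of "A - E r"] finite_A arcs_sym sw single.prems(4) by blast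
  moreover have "E r \<union> (A - E r) = A" using reg by (auto simp: region_def)
  ultimately show ?case using single.prems(5) by auto
next
  case (extend S t s)
  let ?S = "insert s S"
  define D where "D = {e \<in> A. e \<in> B s \<times> B s \<and> (\<forall>r\<in>?S. e \<notin> E r)}"
  have reg: "region (B r) (E r) (W r)" if "r \<in> ?S" for r
    using elim_region extend.prems(1) that by blast
  have sw: "prod.swap e \<in> E r \<longleftrightarrow> e \<in> E r" if "r \<in> ?S" for e r
    using reg[OF that] unfolding region_def by (metis swap_swap)
  have "prod.swap e \<in> D" if "e \<in> D" for e
    using that arcs_sym[of e] sw[of _ e] by (auto simp: D_def)
  then have el: "elim (B s) (E s \<union> D) (W s)"
    using extend.prems(1) finite_subset[OF _ finite_A, of D] by (intro elim_add_arcs) (auto simp: D_def)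
  have B_t: "v \<in> B t" if "v \<in> B s" "v \<in> B r" "r \<in> S" for v r
    using extend.hyps(4) that by blast
  \<comment> \<open>A vertex of \<open>B s - B t\<close> occurs in no other remaining bag and in
    nothing merged into one, so all its arcs are in \<open>E s\<close> or \<open>D\<close>;
    \<open>forget\<close> demands this.\<close>
  have "e \<in> E s \<union> D" if e: "e \<in> A" "fst e \<in> B s - B t" for e
  proof (rule ccontr)
    assume ne: "e \<notin> E s \<union> D"
    have "e \<notin> E r" if "r \<in> S" for r
    proof
      assume "e \<in> E r"
      then have "fst e \<in> B r \<union> W r" using reg[of r] that by (auto simp: region_def)
      then show False using e B_t[of "fst e" r] extend.prems(3)[of r s] that by auto
    qed
    then have ne': "\<forall>r\<in>?S. e \<notin> E r" using ne by auto
    then obtain r where "r \<in> ?S" "e \<in> B r \<times> B r" using extend.prems(4)[OF e(1)] by blast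
    then show False using ne ne' e B_t[of "fst e" r] by (cases "r = s") (auto simp: D_def)
  qed
  moreover have "B t \<subseteq> V" "card (B t) \<le> K" using reg[of t] extend.hyps(2) by (auto simp: region_def)
  ultimately have el': "elim (B t) (E s \<union> D) (W s \<union> (B s - B t))"
    using el by (intro elim.forget)
  have st: "s \<noteq> t" using extend.hyps by auto
  have "E t \<inter> (E s \<union> D) = {}"
    using extend.prems(2)[of t s] extend.hyps(2) st by (auto simp: D_def)
  then have el_t: "elim (B t) (E t \<union> (E s \<union> D)) (W t \<union> (W s \<union> (B s - B t)))"
    using elim.join[OF extend.prems(1)[of t] el'] extend.hyps(2) by blast
  define E' W' where "E' = E(t := E t \<union> (E s \<union> D))" and "W' = W(t := W t \<union> (W s \<union> (B s - B t)))"
  show ?case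
  proof (rule extend.IH[of E' W'])
    show "elim (B r) (E' r) (W' r)" if "r \<in> S" for r
      using that el_t extend.prems(1)[of r] by (auto simp: E'_def W'_def)
  next
    have D: "E r \<inter> (E t \<union> (E s \<union> D)) = {}" if "r \<in> S" "r \<noteq> t" for r
      using that extend.prems(2)[of r t] extend.prems(2)[of r s] extend.hyps(2,3)
      by (auto simp: D_def)
    show "E' q \<inter> E' r = {}" if "q \<in> S" "r \<in> S" "q \<noteq> r" for q r
      using that D[of q] D[of r] extend.prems(2)[of q r] unfolding E'_def by auto
  next
    show "W' q \<inter> B r = {}" if "q \<in> S" "r \<in> S" for q r
      using that extend.prems(3)[of q r] extend.prems(3)[of s r] B_t unfolding W'_def by auto
  next
    fix e assume e: "e \<in> A" and ne: "\<forall>r\<in>S. e \<notin> E' r"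
    have "e \<notin> E t \<union> (E s \<union> D)" using ne extend.hyps(2) by (auto simp: E'_def)
    moreover have "e \<notin> E r" if "r \<in> S" for r
      using ne that by (cases "r = t") (auto simp: E'_def)
    ultimately have "\<forall>r\<in>?S. e \<notin> E r" by auto
    then obtain r where "r \<in> ?S" "e \<in> B r \<times> B r" using extend.prems(4)[OF e] by blast
    moreover have "r \<noteq> s"
      using calculation(2) \<open>e \<notin> E t \<union> (E s \<union> D)\<close> \<open>\<forall>r\<in>?S. e \<notin> E r\<close> e by (auto simp: D_def)
    ultimately show "\<exists>r\<in>S. e \<in> B r \<times> B r" by auto
  next
    show "V \<subseteq> (\<Union>r\<in>S. B r \<union> W' r)"
    proof
      fix v assume "v \<in> V"
      then obtain r where r: "r \<in> ?S" "v \<in> B r \<union> W r" using extend.prems(5) by blast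
      have "v \<in> B t \<union> W' t" if "r = s" using r that by (auto simp: W'_def)
      moreover have "v \<in> B r \<union> W' r" using r by (auto simp: W'_def)
      ultimately show "v \<in> (\<Union>r\<in>S. B r \<union> W' r)" using r(1) extend.hyps(2) by blast
    qed
  qed
qed

end

section \<open>Optimal decompositions and the conclusion\<close>

lemma tree_decomposition_trivial:
  assumes "pair_graph G"
  shows "tree_decomposition G (\<lparr>pverts = {0 :: nat}, parcs = {}\<rparr>) (\<lambda>_. pverts G)"
proof -
  let ?T = "\<lparr>pverts = {0 :: nat}, parcs = {}\<rparr>"
  interpret G: pair_graph G by fact
  have "pair_graph ?T" by unfold_locales (auto simp: symmetric_def arcs_ends_def intro: symI)
  have conn: "connected D" if "verts D = {0 :: nat}" for D :: "(nat, nat \<times> nat) pre_digraph"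
    using that by (auto simp: connected_def strongly_connected_def reachable_def)
  have "undirected_tree ?T"
    unfolding undirected_tree_def using \<open>pair_graph ?T\<close> conn[of "with_proj ?T"] by simp
  then show ?thesis
    unfolding tree_decomposition_def
    using G.in_arcsD1 G.in_arcsD2 conn[of "with_proj ?T \<restriction> {0}"] by auto
qed

text \<open>\<open>int\<close> is not well-ordered, so the minimum is taken over the largest bag
  size, a natural number; the one-bag decomposition makes the set of candidates nonempty.\<close>

lemma treewidth_attained:
  fixes G :: "'a pair_pre_digraph"
  assumes "pair_graph G"
  obtains T :: "nat pair_pre_digraph" and B where "tree_decomposition G T B"
    and "treewidth G = decomposition_width T B"
proof -
  let ?m = "\<lambda>(T :: nat pair_pre_digraph, B :: nat \<Rightarrow> 'a set). Max ((\<lambda>t. card (B t)) ` pverts T)"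
  obtain T B where TB: "tree_decomposition G T B"
    and min: "\<And>T' B'. tree_decomposition G T' B' \<Longrightarrow> ?m (T, B) \<le> ?m (T', B')"
    using ex_has_least_nat[of "\<lambda>(T, B). tree_decomposition G T B" _ ?m]
      tree_decomposition_trivial[OF assms] by fast
  have "treewidth G = decomposition_width T B"
    unfolding treewidth_def
    using TB min by (intro Least_equality) (fastforce simp: decomposition_width_def)+
  then show thesis using that TB by blast
qed

theorem theorem6p3:
  fixes G :: "'a pair_pre_digraph" and k :: int
  assumes "pair_graph G" and "treewidth G = k"
  shows "\<exists>H :: nat pair_pre_digraph.
    pair_graph H \<and> subdivision_of G H \<and> int (blind_cop_width 1 H) \<le> k + 3"
proof -
  interpret G: pair_graph G by fact
  obtain T :: "nat pair_pre_digraph" and B where dec: "tree_decomposition G T B"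
    and width: "treewidth G = decomposition_width T B"
    using treewidth_attained[OF assms(1)] .
  define K where "K = Max ((\<lambda>t. card (B t)) ` pverts T)"
  have k: "k = int K - 1" using width assms(2) by (simp add: K_def decomposition_width_def)
  have tree: "undirected_tree T" and cover: "(\<Union>t\<in>pverts T. B t) = pverts G"
    and edges: "\<And>u v. (u, v) \<in> parcs G \<Longrightarrow> \<exists>t\<in>pverts T. u \<in> B t \<and> v \<in> B t"
    and conn: "\<And>v. v \<in> pverts G \<Longrightarrow> connected (with_proj T \<restriction> {t \<in> pverts T. v \<in> B t})"
    using dec unfolding tree_decomposition_def by auto
  interpret T: pair_graph T using tree by (simp add: undirected_tree_def)
  interpret cop_game "pverts G" "parcs G" K
  proof
    show "prod.swap e \<in> parcs G" if "e \<in> parcs G" for e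
      using that G.pair_sym_arcs by (cases e) (auto simp: symmetric_def dest: symD)
    show "parcs G \<subseteq> pverts G \<times> pverts G" using G.in_arcsD1 G.in_arcsD2 by auto
    show "(v, v) \<notin> parcs G" for v using G.pair_no_loops[of "(v, v)"] by auto
  qed (rule G.pair_finite_verts)
  have "running_intersection B (pverts T)"
    by (rule running_intersection_of_tree[OF tree]) (use conn cover in simp)
  moreover have "elim (B t) {} {}" if "t \<in> pverts T" for t
    using that cover T.pair_finite_verts by (intro elim.bag) (auto simp: K_def)
  ultimately obtain X W where el: "elim X (parcs G) W" and XW: "pverts G \<subseteq> X \<union> W"
    using elim_of_running_intersection[of B "pverts T" "\<lambda>_. {}" "\<lambda>_. {}"] cover edges by fastforce
  obtain l T where l: "\<forall>e\<in>parcs G. 0 \<le> l e \<and> 2 \<le> l e \<and> l (prod.swap e) = l e"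
    and T: "\<And>c. valid_lengths l \<Longrightarrow>
      \<exists>n F p. n \<le> T \<and> reach l (parcs G) n c F p \<and> clean X (parcs G) W F p"
    using elim_strategy[OF el, of 0] by blast
  have lengths: "valid_lengths l" using l by (simp add: valid_lengths_def)
  obtain g :: "'a \<Rightarrow> nat" where g: "inj_on g (pverts G)"
    using finite_imp_inj_to_nat_seg[OF G.pair_finite_verts] by blast
  interpret subdivided_game "pverts G" "parcs G" K g l
    by unfold_locales (fact g, fact lengths)
  obtain n F p where "reach l (parcs G) n (pverts G, l) F p" "clean X (parcs G) W F p"
    using T[OF lengths] by blast
  then have "blind_cop_width 1 H \<le> K + 2" using blind_cop_width_H XW by blast
  then have "int (blind_cop_width 1 H) \<le> k + 3" using k by linarith
  then show ?thesis using pair_graph_H subdivision_of_H by blast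
qed

end
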